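(* Let $s$ be a positive integer and $m$ a nonnegative integer. The number of self-conjugate $(s,s+1,s+2,s+3)$-core partitions with $m$ corners is \[ \binom{\lfloor \frac{s}{2}\rfloor-\lfloor \frac{m}{2} \rfloor}{\lfloor \frac{s}{2} \rfloor-m}\binom{\lfloor \frac{s+1}{2} \rfloor-\lfloor \frac{m+1}{2} \rfloor}{\lfloor \frac{m}{2} \rfloor}. \]
   Context: A partition is a finite (possibly empty) non-increasing sequence of positive integers, identified with its Young diagram. The number of corners of a partition is its number of distinct part sizes. The hook length of a box is the number of boxes to its right in the same row plus the number of boxes below it in the same column plus $1$. A partition is an $s$-core if no box has hook length $s$, and an $(s_1,\dots,s_q)$-core if it is an $s_i$-core for every $i$. A partition is self-conjugate if its Young diagram is invariant under reflection in the main diagonal. A binomial coefficient with negative lower entry is understood to be $0$. *)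

theory Defs
  imports Complex_Main
begin

definition is_partition :: "nat list \<Rightarrow> bool" where
  "is_partition p \<longleftrightarrow> sorted_wrt (\<ge>) p \<and> (\<forall>x\<in>set p. 0 < x)"

text \<open>Boxes are pairs (row, column), both counted from 0.\<close>

definition young_diagram :: "nat list \<Rightarrow> (nat \<times> nat) set" where
  "young_diagram p = {(i, j). i < length p \<and> j < p ! i}"

definition corners :: "nat list \<Rightarrow> nat" where
  "corners p = card (set p)"

definition hook_length :: "nat list \<Rightarrow> nat \<times> nat \<Rightarrow> nat" where
  "hook_length p = (\<lambda>(i, j).
     card {j'. j < j' \<and> (i, j') \<in> young_diagram p} +
     card {i'. i < i' \<and> (i', j) \<in> young_diagram p} + 1)"

definition is_core :: "nat \<Rightarrow> nat list \<Rightarrow> bool" where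
  "is_core s p \<longleftrightarrow> (\<forall>b\<in>young_diagram p. hook_length p b \<noteq> s)"

definition is_simultaneous_core :: "nat set \<Rightarrow> nat list \<Rightarrow> bool" where
  "is_simultaneous_core S p \<longleftrightarrow> (\<forall>s\<in>S. is_core s p)"

definition self_conjugate :: "nat list \<Rightarrow> bool" where
  "self_conjugate p \<longleftrightarrow> prod.swap ` young_diagram p = young_diagram p"

text \<open>
  Binomial coefficient with integer entries, zero for a negative lower entry. A negative upper
  entry with a nonnegative lower entry has the usual polynomial meaning of \<open>gchoose\<close>.
\<close>

definition int_binom :: "int \<Rightarrow> int \<Rightarrow> real" where
  "int_binom n k = (if k < 0 then 0 else of_int n gchoose nat k)"

end

theory Submission
  imports Defs "HOL-Library.Infinite_Set"
begin

text \<open>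
  A partition with parts \<open>\<lambda>\<^sub>0 \<ge> \<lambda>\<^sub>1 \<ge> \<dots>\<close> (continued by zeros) is encoded by its Maya diagram
  \<open>X = {\<lambda>\<^sub>i - i - 1}\<close>. Hook lengths are the differences of elements of \<open>X\<close> and non-elements below
  them, so being a \<open>t\<close>-core means that \<open>X\<close> is closed under subtracting \<open>t\<close>; self-conjugacy means
  that \<open>x \<mapsto> -1 - x\<close> exchanges \<open>X\<close> with its complement; corners are the \<open>x \<in> X\<close> with \<open>x - 1 \<notin> X\<close>.

  Let \<open>H c\<close> be the largest \<open>i\<close> with \<open>c + i (s + 1) \<in> X\<close>, the profile of the abacus with \<open>s + 1\<close>
  runners. Closure under \<open>s\<close>, \<open>s + 2\<close> and \<open>s + 3\<close> says that \<open>H\<close> is a lattice path with steps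
  \<open>-1, 0, 1\<close> and no two consecutive up-steps, and corners become the up-steps in one period.
  By periodicity and antisymmetry \<open>H\<close> is determined by its steps at \<open>1, \<dots>, \<lfloor>s/2\<rfloor>\<close>: one chooses
  the sparse set of \<open>\<lfloor>m/2\<rfloor>\<close> up-steps, and then \<open>\<lfloor>(m+1)/2\<rfloor>\<close> down-steps among the remaining
  positions. This gives the two binomial coefficients.
\<close>

subsection \<open>Maya diagrams\<close>

definition part :: "nat list \<Rightarrow> nat \<Rightarrow> nat" where
  "part p i = (if i < length p then p ! i else 0)"

definition conj_part :: "nat list \<Rightarrow> nat \<Rightarrow> nat" where
  "conj_part p j = card {i. j < part p i}"

definition maya :: "nat list \<Rightarrow> int set" where
  "maya p = range (\<lambda>i. int (part p i) - int i - 1)"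

text \<open>The \<open>n\<close>-th value of an increasing enumeration is the \<open>n\<close>-th
  smallest element of its range. If two enumerations agree below \<open>n\<close>, then
  \<open>v n\<close> equals some \<open>u j\<close> with \<open>j\<close> not below
  \<open>n\<close>, so \<open>u n \<le> v n\<close>; symmetry gives equality.\<close>

lemma strict_mono_range_unique:
  fixes f g :: "nat \<Rightarrow> int"
  assumes f: "strict_mono f" and g: "strict_mono g" and "range f = range g"
  shows "f = g"
proof
  fix n
  show "f n = g n"
  proof (induction n rule: less_induct)
    case (less n)
    have le: "u n \<le> v n"
      if u: "strict_mono u" and v: "strict_mono v" and "range u = range v"
        and eq: "\<forall>i<n. u i = v i" for u v :: "nat \<Rightarrow> int"
    proof -
      obtain j where j: "v n = u j"
        using \<open>range u = range v\<close> by (metis rangeE rangeI)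
      have "\<not> j < n"
        using eq j v by (metis less_irrefl strict_mono_less)
      then show ?thesis
        using j u by (simp add: strict_mono_less_eq)
    qed
    show ?case
      using le[OF f g assms(3)] le[OF g f assms(3)[symmetric]] less.IH by (intro order_antisym) simp_all
  qed
qed

section \<open>Partitions as eventually zero sequences, and their conjugates\<close>

lemma young_diagram_part: "young_diagram p = {(i, j). j < part p i}"
  by (auto simp: young_diagram_def part_def split: if_splits)

lemma antimono_part:
  assumes "is_partition p" "i \<le> j"
  shows "part p j \<le> part p i"
proof (cases "i = j")
  case False
  then show ?thesis
    using assms by (auto simp: is_partition_def part_def sorted_wrt_iff_nth_less)
qed simp

lemma less_length_iff_part:
  assumes "is_partition p"
  shows "i < length p \<longleftrightarrow> 0 < part p i"
  using assms by (auto simp: is_partition_def part_def)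

lemma set_eq_part:
  assumes "is_partition p"
  shows "set p = {v. 0 < v \<and> v \<in> range (part p)}"
proof -
  have "set p = part p ` {i. i < length p}"
    by (auto simp: set_conv_nth part_def)
  also have "\<dots> = {v. 0 < v \<and> v \<in> range (part p)}"
    unfolding less_length_iff_part[OF assms] by blast
  finally show ?thesis .
qed

lemma part_inject:
  assumes "is_partition p" "is_partition q" "part p = part q"
  shows "p = q"
proof (rule nth_equalityI)
  have "i < length p \<longleftrightarrow> i < length q" for i
    using assms less_length_iff_part by simp
  then show "length p = length q"
    by (metis less_irrefl linorder_neqE_nat)
  then show "p ! i = q ! i" if "i < length p" for i
    using that fun_cong[OF assms(3), of i] by (simp add: part_def)
qed

lemma partition_of_sequence:
  fixes L :: "nat \<Rightarrow> nat"
  assumes anti: "\<And>i j. i \<le> j \<Longrightarrow> L j \<le> L i" and "L n = 0"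
  obtains p where "is_partition p" "part p = L"
proof
  define b where "b = (LEAST n. L n = 0)"
  have "L b = 0"
    unfolding b_def using \<open>L n = 0\<close> by (rule LeastI)
  have pos: "0 < L i" if "i < b" for i
    using not_less_Least[OF that[unfolded b_def]] by simp
  have zero: "L i = 0" if "b \<le> i" for i
    using anti[OF that] \<open>L b = 0\<close> by simp
  show "is_partition (map L [0..<b])"
    using anti pos by (auto simp: is_partition_def sorted_wrt_iff_nth_less)
  show "part (map L [0..<b]) = L"
    using zero by (auto simp: part_def fun_eq_iff)
qed

lemma downward_closed_nat_set:
  fixes S :: "nat set"
  assumes "\<And>i j. i \<le> j \<Longrightarrow> j \<in> S \<Longrightarrow> i \<in> S" "n \<notin> S"
  shows "S = {..<card S}"
proof -
  define b where "b = (LEAST n. n \<notin> S)"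
  have "b \<notin> S"
    unfolding b_def using \<open>n \<notin> S\<close> by (rule LeastI)
  moreover have "i \<in> S" if "i < b" for i
    using not_less_Least[OF that[unfolded b_def]] by simp
  ultimately have "S = {..<b}"
    using assms(1) by (auto simp: not_less) (meson leI)
  then show ?thesis by simp
qed

text \<open>The rows reaching past column \<open>j\<close> form an initial segment, so their number
  decides membership. All later facts about the conjugate go through this Galois-type
  equivalence.\<close>

lemma less_conj_part_iff:
  assumes "is_partition p"
  shows "i < conj_part p j \<longleftrightarrow> j < part p i"
proof -
  have "{i. j < part p i} = {..<card {i. j < part p i}}"
  proof (rule downward_closed_nat_set)
    show "length p \<notin> {i. j < part p i}"
      by (simp add: part_def)
  qed (use antimono_part[OF assms] less_le_trans in blast)
  then show ?thesis
    by (auto simp: conj_part_def)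
qed

lemma antimono_conj_part:
  assumes "is_partition p" "i \<le> j"
  shows "conj_part p j \<le> conj_part p i"
proof (rule ccontr)
  assume "\<not> conj_part p j \<le> conj_part p i"
  then have "j < part p (conj_part p i)"
    using less_conj_part_iff[OF assms(1), of "conj_part p i" j] by simp
  then have "conj_part p i < conj_part p i"
    using less_conj_part_iff[OF assms(1), of "conj_part p i" i] \<open>i \<le> j\<close> by simp
  then show False by simp
qed

lemma self_conjugate_iff:
  assumes "is_partition p"
  shows "self_conjugate p \<longleftrightarrow> conj_part p = part p"
proof -
  have "self_conjugate p \<longleftrightarrow> (\<forall>i j. i < conj_part p j \<longleftrightarrow> i < part p j)"
    unfolding self_conjugate_def young_diagram_part less_conj_part_iff[OF assms]
    by (auto simp: set_eq_iff image_iff)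
  also have "\<dots> \<longleftrightarrow> conj_part p = part p"
    by (auto simp: fun_eq_iff) (metis less_irrefl linorder_neqE_nat)
  finally show ?thesis .
qed

section \<open>Hooks, cores, self-conjugacy and corners on the Maya diagram\<close>

lemma strict_mono_maya:
  assumes "is_partition p"
  shows "strict_mono (\<lambda>i. - (int (part p i) - int i - 1))"
proof (rule strict_monoI)
  show "- (int (part p i) - int i - 1) < - (int (part p j) - int j - 1)" if "i < j" for i j
    using antimono_part[OF assms, of i j] that by simp
qed

lemma strict_mono_conj_maya:
  assumes "is_partition p"
  shows "strict_mono (\<lambda>j. int j - int (conj_part p j))"
proof (rule strict_monoI)
  show "int i - int (conj_part p i) < int j - int (conj_part p j)" if "i < j" for i j
    using antimono_conj_part[OF assms, of i j] that by simp
qed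

text \<open>Along the boundary path of the diagram, rows label the steps in one direction and
  columns those in the other, and every integer labels exactly one step. A missing \<open>z\<close>
  belongs to the column whose length is the number of elements of the Maya diagram above
  \<open>z\<close>.\<close>

lemma Compl_maya:
  assumes "is_partition p"
  shows "- maya p = range (\<lambda>j. int j - int (conj_part p j))"
proof (intro equalityI subsetI)
  fix z assume z: "z \<in> - maya p"
  have "int (part p (length p + nat (- z))) - int (length p + nat (-z)) - 1 < z"
    by (simp add: part_def)
  define i where "i = (LEAST i. int (part p i) - int i - 1 < z)"
  have i: "int (part p i) - int i - 1 < z"
    unfolding i_def by (rule LeastI) fact
  have prev: "z < int (part p i') - int i' - 1" if "i' < i" for i'
  proof -
    have "\<not> int (part p i') - int i' - 1 < z"
      using not_less_Least[OF that[unfolded i_def]] .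
    moreover have "int (part p i') - int i' - 1 \<noteq> z"
      using z by (auto simp: maya_def)
    ultimately show ?thesis by simp
  qed
  \<comment> \<open>The column is forced by \<open>z = j - i\<close>. Here \<open>nat\<close> loses
    nothing: parts are nonnegative and the element of row \<open>i\<close> lies below
    \<open>z\<close>.\<close>
  define j where "j = nat (z + int i)"
  have j: "int j = z + int i"
    using i by (simp add: j_def)
  have "i' < conj_part p j \<longleftrightarrow> i' < i" for i'
    unfolding less_conj_part_iff[OF assms]
  proof
    assume "j < part p i'"
    then show "i' < i"
      using i j antimono_part[OF assms, of i i'] by (cases "i' < i") auto
  next
    assume "i' < i"
    then have "i' \<le> i - 1" and "z < int (part p (i - 1)) - int (i - 1) - 1"
      using prev[of "i - 1"] by auto
    then show "j < part p i'"
      using j antimono_part[OF assms, of i' "i - 1"] \<open>i' < i\<close> by (simp add: of_nat_diff)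
  qed
  then have "conj_part p j = i"
    by (metis less_irrefl linorder_neqE_nat)
  then show "z \<in> range (\<lambda>j. int j - int (conj_part p j))"
    using j by (intro image_eqI[of _ _ j]) auto
next
  fix z assume "z \<in> range (\<lambda>j. int j - int (conj_part p j))"
  then obtain j where "z = int j - int (conj_part p j)" by auto
  \<comment> \<open>Over the integers the difference is
    \<open>(part p i - j) + (conj_part p j - i) - 1\<close>. Both brackets are positive for a box
    and at most zero otherwise, so it never vanishes.\<close>
  moreover have "int (part p i) - int i - 1 \<noteq> int j - int (conj_part p j)" for i
    using less_conj_part_iff[OF assms, of i j] by (cases "j < part p i") auto
  ultimately show "z \<in> - maya p"
    unfolding maya_def by blast
qed

lemma hook_length_eq:
  assumes "is_partition p" "(i, j) \<in> young_diagram p"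
  shows "int (hook_length p (i, j)) = (int (part p i) - int i - 1) - (int j - int (conj_part p j))"
proof -
  have "{j'. j < j' \<and> (i, j') \<in> young_diagram p} = {j<..<part p i}"
    "{i'. i < i' \<and> (i', j) \<in> young_diagram p} = {i<..<conj_part p j}"
    by (auto simp: young_diagram_part less_conj_part_iff[OF assms(1)])
  then have "hook_length p (i, j) = (part p i - Suc j) + (conj_part p j - Suc i) + 1"
    by (simp add: hook_length_def)
  moreover have "j < part p i" "i < conj_part p j"
    using assms by (auto simp: young_diagram_part less_conj_part_iff)
  ultimately show ?thesis by simp
qed

text \<open>A hook length is an element minus a non-element, and pairs \<open>(i, j)\<close> outside
  the diagram give negative differences. So a positive \<open>t\<close> is not a hook length iff no
  element exceeds a non-element by exactly \<open>t\<close>.\<close>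

lemma is_core_iff_maya:
  assumes p: "is_partition p" and "0 < t"
  shows "is_core t p \<longleftrightarrow> (\<forall>x\<in>maya p. x - int t \<in> maya p)"
proof -
  have "is_core t p \<longleftrightarrow>
      (\<forall>i j. (int (part p i) - int i - 1) - (int j - int (conj_part p j)) \<noteq> int t)"
  proof -
    have "(int (part p i) - int i - 1) - (int j - int (conj_part p j)) \<noteq> int t"
      if "\<not> j < part p i" for i j
      using that less_conj_part_iff[OF p, of i j] \<open>0 < t\<close> by auto
    moreover have "hook_length p (i, j) \<noteq> t \<longleftrightarrow>
        (int (part p i) - int i - 1) - (int j - int (conj_part p j)) \<noteq> int t"
      if "j < part p i" for i j
      using hook_length_eq[OF p, of i j] that by (auto simp: young_diagram_part)
    ultimately show ?thesis
      unfolding is_core_def young_diagram_part by blast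
  qed
  also have "\<dots> \<longleftrightarrow> (\<forall>x\<in>maya p. \<forall>y\<in>- maya p. x - y \<noteq> int t)"
    unfolding Compl_maya[OF p] by (auto simp: maya_def)
  also have "\<dots> \<longleftrightarrow> (\<forall>x\<in>maya p. x - int t \<in> maya p)"
  proof (intro iffI ballI)
    fix x assume "\<forall>x\<in>maya p. \<forall>y\<in>- maya p. x - y \<noteq> int t" "x \<in> maya p"
    then have "x - int t \<in> - maya p \<Longrightarrow> x - (x - int t) \<noteq> int t"
      by blast
    then show "x - int t \<in> maya p"
      by auto
  next
    fix x y assume "\<forall>x\<in>maya p. x - int t \<in> maya p" "x \<in> maya p" "y \<in> - maya p"
    then have "x - int t \<noteq> y"
      by blast
    then show "x - y \<noteq> int t"
      by simp
  qed
  finally show ?thesis .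
qed

text \<open>The non-elements and the reflected elements are both listed increasingly, so equality of
  the two sequences, which is self-conjugacy, amounts to equality of their ranges.\<close>

lemma self_conjugate_iff_maya:
  assumes p: "is_partition p"
  shows "self_conjugate p \<longleftrightarrow> (\<forall>x. x \<in> maya p \<longleftrightarrow> - 1 - x \<notin> maya p)"
proof -
  have "self_conjugate p \<longleftrightarrow>
      (\<lambda>j. int j - int (conj_part p j)) = (\<lambda>i. - (int (part p i) - int i - 1) - 1)"
    unfolding self_conjugate_iff[OF p] by (auto simp: fun_eq_iff)
  also have "\<dots> \<longleftrightarrow> range (\<lambda>j. int j - int (conj_part p j)) =
      range (\<lambda>i. - (int (part p i) - int i - 1) - 1)"
  proof
    assume eq: "range (\<lambda>j. int j - int (conj_part p j)) =
      range (\<lambda>i. - (int (part p i) - int i - 1) - 1)"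
    have "strict_mono (\<lambda>i. - (int (part p i) - int i - 1) - 1)"
      using strict_mono_maya[OF p] by (simp add: strict_mono_def)
    then show "(\<lambda>j. int j - int (conj_part p j)) = (\<lambda>i. - (int (part p i) - int i - 1) - 1)"
      using strict_mono_range_unique strict_mono_conj_maya[OF p] eq by blast
  qed (simp only:)
  also have "\<dots> \<longleftrightarrow> - maya p = (\<lambda>x. - 1 - x) ` maya p"
  proof -
    have "(\<lambda>x. - 1 - x) ` maya p = range (\<lambda>i. - (int (part p i) - int i - 1) - 1)"
      unfolding maya_def image_image by simp
    then show ?thesis
      unfolding Compl_maya[OF p] by (simp only:)
  qed
  also have "(\<lambda>x. - 1 - x) ` maya p = {x. - 1 - x \<in> maya p}"
  proof (intro equalityI subsetI)
    fix x assume "x \<in> {x. - 1 - x \<in> maya p}"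
    then show "x \<in> (\<lambda>x. - 1 - x) ` maya p"
      by (intro image_eqI[of _ _ "- 1 - x"]) auto
  qed auto
  also have "- maya p = {x. - 1 - x \<in> maya p} \<longleftrightarrow> (\<forall>x. x \<in> maya p \<longleftrightarrow> - 1 - x \<notin> maya p)"
    by blast
  finally show ?thesis .
qed

lemma inj_on_maya: "inj_on maya {p. is_partition p}"
proof (rule inj_onI, simp)
  fix p q assume pq: "is_partition p" "is_partition q" "maya p = maya q"
  have "range (\<lambda>i. - (int (part p i) - int i - 1)) = range (\<lambda>i. - (int (part q i) - int i - 1))"
    using arg_cong[OF pq(3), of "image uminus"] unfolding maya_def image_image .
  then have "(\<lambda>i. - (int (part p i) - int i - 1)) = (\<lambda>i. - (int (part q i) - int i - 1))"
    using strict_mono_range_unique strict_mono_maya pq(1,2) by blast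
  then have "part p = part q"
    by (auto simp: fun_eq_iff)
  then show "p = q"
    using pq part_inject by blast
qed

lemma maya_less:
  assumes "is_partition p" "x \<in> maya p"
  shows "x < int (part p 0)"
proof -
  obtain i where "x = int (part p i) - int i - 1"
    using assms(2) by (auto simp: maya_def)
  then show ?thesis
    using antimono_part[OF assms(1), of 0 i] by simp
qed

text \<open>Each part size is represented by the last row of that size. Row \<open>i\<close> is such
  a row iff its element has no neighbour directly below. The zeros form an endless block without a
  last row and contribute nothing.\<close>

lemma corners_eq_card_maya:
  assumes p: "is_partition p"
  shows "corners p = card {x \<in> maya p. x - 1 \<notin> maya p}"
proof -
  define x where "x i = int (part p i) - int i - 1" for i
  define I where "I = {i. part p (Suc i) < part p i}"
  have maya: "maya p = range x"
    unfolding maya_def x_def ..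
  have xless: "x j < x i" if "i < j" for i j
    using strict_monoD[OF strict_mono_maya[OF p] that] by (simp add: x_def)
  then have inj: "inj x"
    by (metis injI less_irrefl linorder_neqE_nat)
  have last: "x i - 1 \<notin> maya p \<longleftrightarrow> i \<in> I" for i
  proof
    assume "x i - 1 \<notin> maya p"
    moreover have "x (Suc i) \<in> maya p"
      unfolding maya by blast
    ultimately have "x (Suc i) \<noteq> x i - 1"
      by auto
    then show "i \<in> I"
      using antimono_part[OF p, of i "Suc i"] by (auto simp: x_def I_def)
  next
    assume "i \<in> I"
    have False if "x j = x i - 1" for j
    proof -
      have "i < j"
        using that xless[of j i] by (cases i j rule: linorder_cases) auto
      then have "x j \<le> x (Suc i)"
        using xless[of "Suc i" j] by (cases "j = Suc i") auto
      then show False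
        using that \<open>i \<in> I\<close> by (auto simp: x_def I_def)
    qed
    then show "x i - 1 \<notin> maya p"
      unfolding maya by (metis rangeE)
  qed
  have "{y \<in> maya p. y - 1 \<notin> maya p} = x ` I"
    using last unfolding maya by blast
  then have "card {y \<in> maya p. y - 1 \<notin> maya p} = card I"
    using inj by (simp add: card_image inj_on_subset)
  moreover have "set p = part p ` I"
  proof (intro equalityI subsetI)
    fix v assume "v \<in> set p"
    then obtain i where i: "0 < v" "v = part p i"
      using set_eq_part[OF p] by auto
    \<comment> \<open>The first row shorter than \<open>v\<close>; row \<open>j - 1\<close> is then
      the last one of length \<open>v\<close>.\<close>
    define j where "j = (LEAST j. part p j < v)"
    have "part p (length p) < v"
      using i by (simp add: part_def)
    then have j: "part p j < v"
      unfolding j_def by (rule LeastI)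
    have "i < j"
      using j i antimono_part[OF p, of j i] by (cases "i < j") auto
    then have "\<not> part p (j - 1) < v"
      using not_less_Least[of "j - 1" "\<lambda>j. part p j < v"] unfolding j_def[symmetric] by auto
    moreover have "part p (j - 1) \<le> v"
      using i \<open>i < j\<close> antimono_part[OF p, of i "j - 1"] by auto
    ultimately show "v \<in> part p ` I"
      using j \<open>i < j\<close> by (intro image_eqI[of _ _ "j - 1"]) (auto simp: I_def)
  next
    fix v assume "v \<in> part p ` I"
    then obtain i where "part p (Suc i) < v" "v = part p i"
      unfolding I_def by blast
    then show "v \<in> set p"
      unfolding set_eq_part[OF p] by simp
  qed
  moreover have "inj_on (part p) I"
  proof (rule inj_onI)
    fix i j assume ij: "i \<in> I" "j \<in> I" "part p i = part p j"
    have "\<not> i < j"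
      using antimono_part[OF p, of "Suc i" j] ij by (auto simp: I_def Suc_le_eq)
    moreover have "\<not> j < i"
      using antimono_part[OF p, of "Suc j" i] ij by (auto simp: I_def Suc_le_eq)
    ultimately show "i = j"
      by simp
  qed
  ultimately show ?thesis
    unfolding corners_def by (metis card_image)
qed

section \<open>Recovering a partition from an antisymmetric set\<close>

lemma negative_mem_antisymmetric:
  fixes X :: "int set"
  assumes "\<And>x. x \<in> X \<longleftrightarrow> - 1 - x \<notin> X" "\<And>x. x \<in> X \<Longrightarrow> x < b" "x < - b"
  shows "x \<in> X"
proof (rule ccontr)
  assume "x \<notin> X"
  then have "- 1 - x < b"
    using assms(1)[of x] assms(2) by blast
  then show False
    using assms(3) by simp
qed

text \<open>Reading \<open>X\<close> downwards from \<open>B - 1\<close> gives a set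
  \<open>S\<close> of naturals. Reflection pairs \<open>n\<close> with \<open>2 * B - 1 - n\<close>,
  so exactly \<open>B\<close> elements of \<open>S\<close> lie below \<open>2 * B\<close>. This
  balance makes the enumeration of \<open>S\<close> end as \<open>B + i\<close>, so that the parts
  end in zeros.\<close>

lemma maya_surj:
  fixes X :: "int set"
  assumes anti: "\<And>x. x \<in> X \<longleftrightarrow> - 1 - x \<notin> X" and bdd: "\<And>x. x \<in> X \<Longrightarrow> x < b"
  obtains p where "is_partition p" "maya p = X"
proof -
  define B where "B = nat b"
  have ltB: "x < int B" if "x \<in> X" for x
    using bdd[OF that] by (simp add: B_def)
  define S where "S = {n. int B - 1 - int n \<in> X}"
  have large: "n \<in> S" if "2 * B \<le> n" for n
    using negative_mem_antisymmetric[OF anti ltB] that by (auto simp: S_def)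
  then have inf: "infinite S"
    by (metis infinite_nat_iff_unbounded_le nat_le_linear)
  have swap: "n \<in> S \<longleftrightarrow> 2 * B - 1 - n \<notin> S" if "n < 2 * B" for n
  proof -
    have eq: "- 1 - (int B - 1 - int n) = int B - 1 - int (2 * B - 1 - n)"
      using that by (simp add: of_nat_diff)
    show ?thesis
      using anti[of "int B - 1 - int n"] unfolding eq S_def mem_Collect_eq .
  qed
  have card_half: "card (S \<inter> {..<2 * B}) = B"
  proof -
    have "2 * B - 1 - n \<in> {..<2 * B} - S" if "n \<in> S \<inter> {..<2 * B}" for n
      using swap[of n] that by simp
    moreover have "2 * B - 1 - n \<in> S \<inter> {..<2 * B}" if "n \<in> {..<2 * B} - S" for n
      using swap[of n] that by simp
    ultimately have "bij_betw (\<lambda>n. 2 * B - 1 - n) (S \<inter> {..<2 * B}) ({..<2 * B} - S)"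
      by (intro bij_betw_byWitness[where f' = "\<lambda>n. 2 * B - 1 - n"] image_subsetI) auto
    then have "card (S \<inter> {..<2 * B}) = card ({..<2 * B} - S)"
      by (rule bij_betw_same_card)
    moreover have "card (S \<inter> {..<2 * B}) + card ({..<2 * B} - S) = 2 * B"
      by (metis card_Int_Diff card_lessThan finite_lessThan inf_commute)
    ultimately show ?thesis by simp
  qed
  have card_below: "card (S \<inter> {..<n}) = n - B" if "2 * B \<le> n" for n
  proof -
    have "S \<inter> {..<n} = (S \<inter> {..<2 * B}) \<union> {2 * B..<n}"
      using large that by auto
    moreover have "card \<dots> = card (S \<inter> {..<2 * B}) + card {2 * B..<n}"
      by (rule card_Un_disjoint) auto
    ultimately show ?thesis
      using card_half that by simp
  qed
  define e where "e = enumerate S"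
  have mono: "strict_mono e"
    unfolding e_def using inf by (rule strict_mono_enumerate)
  have range: "range e = S"
    unfolding e_def using inf by (rule range_enumerate)
  \<comment> \<open>\<open>B + i\<close> lies in \<open>S\<close> and has exactly \<open>i\<close>
    predecessors there: all numbers below it except \<open>B\<close> many.\<close>
  have tail: "e i = B + i" if "B \<le> i" for i
  proof -
    have "B + i \<in> S"
      using large that by simp
    then obtain j where j: "e j = B + i"
      using range by (metis rangeE)
    have "S \<inter> {..<B + i} = {e n | n. e n < e j}"
      unfolding range[symmetric] j by blast
    also have "\<dots> = e ` {..<j}"
      unfolding strict_mono_less[OF mono] by blast
    finally have "S \<inter> {..<B + i} = e ` {..<j}" .
    then have "card (S \<inter> {..<B + i}) = j"
      using mono by (simp add: card_image strict_mono_imp_inj_on inj_on_subset)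
    then show ?thesis
      using card_below[of "B + i"] that j by simp
  qed
  have shift: "e i + d \<le> e (i + d)" for i d
  proof (induction d)
    case (Suc d)
    then show ?case
      using strict_monoD[OF mono, of "i + d" "i + Suc d"] by simp
  qed simp
  have bound: "e i \<le> B + i" for i
    using shift[of i B] tail[of "i + B"] by simp
  \<comment> \<open>The solution of \<open>B - 1 - e i = L i - i - 1\<close>; the subtraction of
    naturals is exact by \<open>bound\<close>.\<close>
  define L where "L i = B + i - e i" for i
  have "L j \<le> L i" if "i \<le> j" for i j
    using shift[of i "j - i"] that by (simp add: L_def)
  moreover have "L B = 0"
    using tail[of B] by (simp add: L_def)
  ultimately obtain p where p: "is_partition p" "part p = L"
    using partition_of_sequence by metis
  have "maya p = (\<lambda>n. int B - 1 - int n) ` S"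
    unfolding maya_def p(2) L_def range[symmetric] image_image
    by (intro image_cong) (use bound in \<open>auto simp: of_nat_diff\<close>)
  also have "\<dots> = X"
  proof (intro equalityI subsetI)
    fix x assume "x \<in> X"
    then show "x \<in> (\<lambda>n. int B - 1 - int n) ` S"
      using ltB[of x] by (intro image_eqI[of _ _ "nat (int B - 1 - x)"]) (auto simp: S_def)
  qed (auto simp: S_def)
  finally show thesis
    using that p by blast
qed

subsection \<open>Abacus profiles\<close>

text \<open>The first clause renames runner \<open>c + (s + 1)\<close> as runner \<open>c\<close>
  moved by one row, the second is self-conjugacy, and the three inequalities are closure under
  subtracting \<open>s\<close>, \<open>s + 2\<close> and \<open>s + 3\<close>, in this order. Taking
  all integers as runners avoids a case split at the end of a period.\<close>

definition profile :: "nat \<Rightarrow> (int \<Rightarrow> int) \<Rightarrow> bool" where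
  "profile s H \<longleftrightarrow>
    (\<forall>c. H (c + (int s + 1)) = H c - 1) \<and>
    (\<forall>c. H (- 1 - c) = - 1 - H c) \<and>
    (\<forall>c. H c - 1 \<le> H (c + 1) \<and> H (c + 1) \<le> H c + 1 \<and> H (c + 2) \<le> H c + 1)"

text \<open>The step at \<open>c\<close> leads from \<open>c - 1\<close> to \<open>c\<close>. Only
  the first half of a period is recorded: reflection gives the second half, and \<open>H 0\<close>
  determines the step at \<open>0\<close>.\<close>

definition ups :: "nat \<Rightarrow> (int \<Rightarrow> int) \<Rightarrow> nat set" where
  "ups s H = {c \<in> {1..s div 2}. H (int c) = H (int c - 1) + 1}"

definition downs :: "nat \<Rightarrow> (int \<Rightarrow> int) \<Rightarrow> nat set" where
  "downs s H = {c \<in> {1..s div 2}. H (int c) = H (int c - 1) - 1}"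

section \<open>Periodicity, reflection and forced values of a profile\<close>

lemma profile_add_mult:
  assumes "profile s H"
  shows "H (c + q * (int s + 1)) = H c - q"
proof (induction q rule: int_induct[where k = 0])
  case (step1 i)
  have "c + (i + 1) * (int s + 1) = (c + i * (int s + 1)) + (int s + 1)"
    by (simp add: algebra_simps)
  then show ?case
    using step1 assms unfolding profile_def by (metis diff_diff_eq)
next
  case (step2 i)
  have "c + i * (int s + 1) = (c + (i - 1) * (int s + 1)) + (int s + 1)"
    by (simp add: algebra_simps)
  then have "H (c + i * (int s + 1)) = H (c + (i - 1) * (int s + 1)) - 1"
    using assms unfolding profile_def by metis
  then show ?case
    using step2 by simp
qed simp

text \<open>Antisymmetry followed by one period: a point reflection of the path over
  \<open>0, ..., s\<close> in its midpoint at height \<open>-1\<close>.\<close>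

lemma profile_reflect:
  assumes "profile s H" "a + b = int s"
  shows "H a = - 2 - H b"
proof -
  have "a = (- 1 - b) + (int s + 1)"
    using assms(2) by simp
  then have "H a = H (- 1 - b) - 1"
    using assms(1) unfolding profile_def by metis
  then show ?thesis
    using assms(1) unfolding profile_def by simp
qed

lemma profile_step:
  assumes "profile s H"
  shows "H c \<le> H (c - 1) + 1" "H (c - 1) - 1 \<le> H c" "H c \<le> H (c - 2) + 1"
proof -
  have "H (c - 1) - 1 \<le> H (c - 1 + 1)" "H (c - 1 + 1) \<le> H (c - 1) + 1"
    "H (c - 2 + 2) \<le> H (c - 2) + 1"
    using assms unfolding profile_def by blast+
  then show "H c \<le> H (c - 1) + 1" "H (c - 1) - 1 \<le> H c" "H c \<le> H (c - 2) + 1"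
    by simp_all
qed

text \<open>The step at \<open>0\<close> changes the height by the odd number
  \<open>2 * H 0 + 1\<close>, so it cannot be flat.\<close>

lemma profile_0:
  assumes "profile s H"
  shows "H (- 1) = - 1 - H 0" "H 0 = 0 \<or> H 0 = - 1"
proof -
  have "H (- 1 - 0) = - 1 - H 0"
    using assms unfolding profile_def by blast
  then show *: "H (- 1) = - 1 - H 0"
    by simp
  show "H 0 = 0 \<or> H 0 = - 1"
    using profile_step(1,2)[OF assms, of 0] * by (simp; linarith)
qed

text \<open>For even \<open>s\<close> the midpoint is its own mirror image. For odd \<open>s\<close>
  the two middle points are mirror images, so their heights differ by an even number and the step
  between them is flat.\<close>

lemma profile_half:
  assumes "profile s H"
  shows "H (int (s div 2)) = - 1"
proof (cases "even s")
  case True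
  then have "int (s div 2) + int (s div 2) = int s"
    by presburger
  from profile_reflect[OF assms this] show ?thesis by simp
next
  case False
  then have "int (s div 2) + 1 + int (s div 2) = int s"
    by presburger
  from profile_reflect[OF assms this] show ?thesis
    using profile_step(1,2)[OF assms, of "int (s div 2) + 1"] by simp
qed

lemma profile_eq_card:
  assumes "profile s H" "n \<le> s div 2"
  shows "H (int n) = H 0 + int (card (ups s H \<inter> {..n})) - int (card (downs s H \<inter> {..n}))"
  using assms(2)
proof (induction n)
  case 0
  have "ups s H \<inter> {..0} = {}" "downs s H \<inter> {..0} = {}"
    by (auto simp: ups_def downs_def)
  then show ?case by simp
next
  case (Suc n)
  let ?c = "\<lambda>A. if Suc n \<in> A then 1 else 0"
  have card: "card (A \<inter> {..Suc n}) = card (A \<inter> {..n}) + ?c A" for A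
    by (simp add: atMost_Suc)
  have "H (int (Suc n)) = H (int n) + ?c (ups s H) - ?c (downs s H)"
    using profile_step(1,2)[OF assms(1), of "int (Suc n)"] Suc.prems
    by (auto simp: ups_def downs_def)
  then show ?case
    using Suc card by auto
qed

text \<open>Counting steps from \<open>H 0\<close> determines the first half of a period, reflection
  the second half, and periodicity everything else.\<close>

lemma profile_eqI:
  assumes H: "profile s H" and H': "profile s H'"
    and "H 0 = H' 0" "ups s H = ups s H'" "downs s H = downs s H'"
  shows "H = H'"
proof
  fix c
  have low: "H n = H' n" if n: "0 \<le> n" "n \<le> int (s div 2)" for n
  proof -
    obtain i where "n = int i"
      using n(1) nonneg_int_cases by blast
    then show ?thesis
      using profile_eq_card[OF H, of i] profile_eq_card[OF H', of i] n assms(3-5) by simp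
  qed
  have period: "H n = H' n" if n: "0 \<le> n" "n \<le> int s" for n
  proof (cases "n \<le> int (s div 2)")
    case False
    have "n + (int s - n) = int s" by simp
    moreover have "int s - n \<le> int (s div 2)"
      using False by linarith
    ultimately show ?thesis
      using profile_reflect[OF H] profile_reflect[OF H'] low[of "int s - n"] n(2) by simp
  qed (use low n in blast)
  have "H (c mod (int s + 1)) = H' (c mod (int s + 1))"
    using period[of "c mod (int s + 1)"] pos_mod_bound[of "int s + 1" c] by simp
  moreover have "c = c mod (int s + 1) + (c div (int s + 1)) * (int s + 1)"
    by (rule mod_div_mult_eq[symmetric])
  ultimately show "H c = H' c"
    using profile_add_mult[OF H] profile_add_mult[OF H'] by metis
qed

section \<open>Corners as up-steps in one period\<close>

text \<open>As steps rise by at most one, a corner \<open>x\<close> has \<open>H x = 0\<close> and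
  \<open>H (x - 1) = - 1\<close>, so its residue carries an up-step. Conversely an up-step at
  \<open>c\<close> has exactly one translate at height \<open>0\<close>, namely
  \<open>c + H c * (s + 1)\<close>.\<close>

lemma card_starts_profile:
  assumes "profile s H"
  shows "card {x. 0 \<le> H x \<and> \<not> 0 \<le> H (x - 1)} = card {c \<in> {0..int s}. H c = H (c - 1) + 1}"
proof -
  let ?N = "int s + 1"
  have shift: "H (c + q * ?N) = H c - q" for c q
    by (rule profile_add_mult[OF assms])
  have shift': "H (c + q * ?N - 1) = H (c - 1) - q" for c q
    using shift[of "c - 1" q] by (simp add: algebra_simps)
  have "bij_betw (\<lambda>c. c + H c * ?N) {c \<in> {0..int s}. H c = H (c - 1) + 1}
      {x. 0 \<le> H x \<and> \<not> 0 \<le> H (x - 1)}"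
  proof (rule bij_betw_byWitness[where f' = "\<lambda>x. x mod ?N"])
    show "\<forall>c\<in>{c \<in> {0..int s}. H c = H (c - 1) + 1}. (c + H c * ?N) mod ?N = c"
      by (auto simp: mod_pos_pos_trivial)
    have zero: "H x = 0" "H (x - 1) = - 1" if "x \<in> {x. 0 \<le> H x \<and> \<not> 0 \<le> H (x - 1)}" for x
      using that profile_step(1)[OF assms, of x] by auto
    have dm: "x mod ?N = x + (- (x div ?N)) * ?N" for x
      by (simp add: minus_div_mult_eq_mod [symmetric])
    have Hmod: "H (x mod ?N) = H x + x div ?N" "H (x mod ?N - 1) = H (x - 1) + x div ?N" for x
      unfolding dm by (simp_all only: shift shift')
    show "\<forall>x\<in>{x. 0 \<le> H x \<and> \<not> 0 \<le> H (x - 1)}. x mod ?N + H (x mod ?N) * ?N = x"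
    proof
      fix x assume x: "x \<in> {x. 0 \<le> H x \<and> \<not> 0 \<le> H (x - 1)}"
      show "x mod ?N + H (x mod ?N) * ?N = x"
        unfolding Hmod zero(1)[OF x] add_0 by (rule mod_div_mult_eq)
    qed
    show "(\<lambda>c. c + H c * ?N) ` {c \<in> {0..int s}. H c = H (c - 1) + 1}
        \<subseteq> {x. 0 \<le> H x \<and> \<not> 0 \<le> H (x - 1)}"
      by (intro image_subsetI CollectI) (simp only: shift shift', simp)
    show "(\<lambda>x. x mod ?N) ` {x. 0 \<le> H x \<and> \<not> 0 \<le> H (x - 1)}
        \<subseteq> {c \<in> {0..int s}. H c = H (c - 1) + 1}"
    proof (intro image_subsetI CollectI conjI)
      fix x assume x: "x \<in> {x. 0 \<le> H x \<and> \<not> 0 \<le> H (x - 1)}"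
      show "H (x mod ?N) = H (x mod ?N - 1) + 1"
        unfolding Hmod zero[OF x] by simp
      show "x mod ?N \<in> {0..int s}"
        using pos_mod_bound[of ?N x] by simp
    qed
  qed
  then show ?thesis
    by (rule bij_betw_same_card[symmetric])
qed

text \<open>The mirror map \<open>c \<mapsto> s + 1 - c\<close> preserves up-steps, so those away
  from \<open>0\<close> come in pairs with one member in the first half. The step at
  \<open>0\<close> is up iff \<open>H 0 = 0\<close>.\<close>

lemma card_ups_period:
  assumes H: "profile s H" and "0 < s"
  shows "card {c \<in> {0..int s}. H c = H (c - 1) + 1} = 2 * card (ups s H) + (if H 0 = 0 then 1 else 0)"
proof -
  define A where "A = int ` ups s H"
  define Z where "Z = (if H 0 = 0 then {0::int} else {})"
  let ?R = "\<lambda>c. int s + 1 - c"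
  have A: "A = {c \<in> {1..int (s div 2)}. H c = H (c - 1) + 1}"
  proof (intro equalityI subsetI)
    fix c assume "c \<in> {c \<in> {1..int (s div 2)}. H c = H (c - 1) + 1}"
    then show "c \<in> A"
      unfolding A_def by (intro image_eqI[of _ _ "nat c"]) (auto simp: ups_def nat_le_iff)
  qed (auto simp: A_def ups_def)
  have half: "c \<le> int s" if "c \<le> int (s div 2)" for c
    using that by linarith
  have refl: "H (?R c) = H (?R c - 1) + 1 \<longleftrightarrow> H c = H (c - 1) + 1" for c
    using profile_reflect[OF H, of "?R c" "c - 1"] profile_reflect[OF H, of "?R c - 1" c] by auto
  have zero: "H 0 = H (0 - 1) + 1 \<longleftrightarrow> H 0 = 0"
    using profile_0[OF H] by auto
  have "{c \<in> {0..int s}. H c = H (c - 1) + 1} = Z \<union> (A \<union> ?R ` A)"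
  proof (intro equalityI subsetI)
    fix c assume c: "c \<in> {c \<in> {0..int s}. H c = H (c - 1) + 1}"
    have "c = 0 \<or> 1 \<le> c \<and> c \<le> int (s div 2) \<or> 1 \<le> ?R c \<and> ?R c \<le> int (s div 2) \<or> ?R c = c"
      using c by auto
    then consider "c = 0" | "1 \<le> c" "c \<le> int (s div 2)" | "1 \<le> ?R c" "?R c \<le> int (s div 2)" | "?R c = c"
      by blast
    then show "c \<in> Z \<union> (A \<union> ?R ` A)"
    proof cases
      case 1
      then show ?thesis
        using c zero by (simp add: Z_def)
    next
      case 2
      then show ?thesis
        using c by (simp add: A)
    next
      case 3
      then have "?R c \<in> A"
        using c refl by (simp add: A)
      moreover have "c = ?R (?R c)" by simp
      ultimately show ?thesis by blast
    next
      case 4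
      \<comment> \<open>The middle step for odd \<open>s\<close> is its own mirror image; an up-step
        there would give \<open>2 * H (c - 1) = - 3\<close>.\<close>
      then have "H c = - 2 - H (c - 1)"
        by (intro profile_reflect[OF H]) simp
      then show ?thesis
        using c by simp presburger
    qed
  next
    fix c assume "c \<in> Z \<union> (A \<union> ?R ` A)"
    then consider "c \<in> Z" | "c \<in> A" | d where "d \<in> A" "c = ?R d"
      by blast
    then show "c \<in> {c \<in> {0..int s}. H c = H (c - 1) + 1}"
    proof cases
      case 1
      then show ?thesis
        using zero by (simp add: Z_def split: if_splits)
    next
      case 2
      then show ?thesis
        using half by (simp add: A)
    next
      case 3
      then show ?thesis
        using refl[of d] half[of d] by (simp add: A)
    qed
  qed
  moreover have fin: "finite A"
    unfolding A by (rule finite_subset[of _ "{1..int (s div 2)}"]) auto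
  moreover have "Z \<inter> (A \<union> ?R ` A) = {}" "A \<inter> ?R ` A = {}"
    by (auto simp: Z_def A)
  moreover have "card (?R ` A) = card A"
    by (rule card_image) (simp add: inj_on_def)
  moreover have "card A = card (ups s H)"
    unfolding A_def by (simp add: card_image)
  ultimately show ?thesis
    by (simp add: card_Un_disjoint Z_def)
qed

lemma card_starts_eq:
  assumes "profile s H" "0 < s"
  shows "card {x. 0 \<le> H x \<and> \<not> 0 \<le> H (x - 1)} = 2 * card (ups s H) + (if H 0 = 0 then 1 else 0)"
  unfolding card_starts_profile[OF assms(1)] by (rule card_ups_period[OF assms])

section \<open>Profiles and their sets of up-steps and down-steps\<close>

text \<open>The range of the up-steps excludes consecutive ones at both ends: \<open>1\<close> is
  barred when the step at \<open>0\<close> is up, and \<open>s div 2\<close> is barred for even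
  \<open>s\<close>, where its mirror image comes right after it. The path goes from
  \<open>e - 1\<close> at \<open>0\<close> to \<open>- 1\<close> at \<open>s div 2\<close>, hence
  \<open>e\<close> more down-steps than up-steps.\<close>

lemma ups_downs_profile:
  assumes H: "profile s H" and "0 < s"
  defines "e \<equiv> if H 0 = 0 then 1 else 0"
  shows "ups s H \<subseteq> {Suc e..<(s + 1) div 2}"
    and "\<forall>i\<in>ups s H. Suc i \<notin> ups s H"
    and "downs s H \<subseteq> {1..s div 2} - ups s H"
    and "card (downs s H) = card (ups s H) + e"
proof -
  show "ups s H \<subseteq> {Suc e..<(s + 1) div 2}"
  proof
    fix c assume "c \<in> ups s H"
    then have c: "1 \<le> c" "c \<le> s div 2" "H (int c) = H (int c - 1) + 1"
      by (auto simp: ups_def)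
    have "H 1 = H 0 + 1 \<Longrightarrow> H 0 \<noteq> 0"
      using profile_step(3)[OF H, of 1] profile_0[OF H] by auto
    then have "Suc e \<le> c"
      using c by (cases "c = 1") (auto simp: e_def)
    moreover have "c < (s + 1) div 2"
    proof (rule ccontr)
      assume "\<not> c < (s + 1) div 2"
      then have s: "s = 2 * c"
        using c(2) by linarith
      have "H (int c) = - 1"
        using profile_half[OF H] s by simp
      moreover have "H (int c + 1) = - 2 - H (int c - 1)"
        using profile_reflect[OF H, of "int c + 1" "int c - 1"] s by simp
      moreover have "H (int c + 1) \<le> H (int c - 1) + 1"
        using profile_step(3)[OF H, of "int c + 1"] by simp
      ultimately show False
        using c(3) by simp
    qed
    ultimately show "c \<in> {Suc e..<(s + 1) div 2}" by simp
  qed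
  show "\<forall>i\<in>ups s H. Suc i \<notin> ups s H"
  proof (intro ballI notI)
    fix i assume "i \<in> ups s H" "Suc i \<in> ups s H"
    then show False
      using profile_step(3)[OF H, of "int (Suc i)"] by (simp add: ups_def)
  qed
  show "downs s H \<subseteq> {1..s div 2} - ups s H"
    by (auto simp: downs_def ups_def)
  have "ups s H \<inter> {..s div 2} = ups s H" "downs s H \<inter> {..s div 2} = downs s H"
    by (auto simp: ups_def downs_def)
  then have "- 1 = H 0 + int (card (ups s H)) - int (card (downs s H))"
    using profile_eq_card[OF H, of "s div 2"] profile_half[OF H] by simp
  then show "card (downs s H) = card (ups s H) + e"
    using profile_0(2)[OF H] by (auto simp: e_def)
qed

text \<open>The path is built from its steps on the first half, reflected to one period and extended
  periodically. Each of its steps is then the value of \<open>w\<close> at the position folded into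
  the first half, so the step conditions reduce to those on \<open>U\<close> and
  \<open>D\<close>.\<close>

lemma profile_from_sets:
  assumes "0 < s" "e \<le> (1::nat)"
    and U: "U \<subseteq> {Suc e..<(s + 1) div 2}" "\<forall>i\<in>U. Suc i \<notin> U"
    and D: "D \<subseteq> {1..s div 2} - U" "card D = card U + e"
  obtains H where "profile s H" "H 0 = int e - 1" "ups s H = U" "downs s H = D"
proof
  define k where "k = int (s div 2)"
  define N where "N = int s + 1"
  define g where "g n = int e - 1 + int (card (U \<inter> {..n})) - int (card (D \<inter> {..n}))" for n
  define G where "G n = (if n \<le> k then g (nat n) else - 2 - g (nat (int s - n)))" for n
  define H where "H c = G (c mod N) - c div N" for c
  \<comment> \<open>The step at \<open>0\<close> leads from \<open>- 1 - (e - 1)\<close> to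
    \<open>e - 1\<close>, hence the value \<open>2 * e - 1\<close>.\<close>
  define w :: "nat \<Rightarrow> int" where
    "w n = (if n = 0 then 2 * int e - 1 else if n \<in> U then 1 else if n \<in> D then - 1 else 0)" for n
  \<comment> \<open>Folds a period along the mirror map \<open>n \<mapsto> N - n\<close> of
    steps.\<close>
  define \<rho> where "\<rho> n = nat (min n (N - n))" for n
  have s: "int s = 2 * k \<or> int s = 2 * k + 1"
    unfolding k_def by presburger
  have Uk: "1 \<le> c \<and> int c \<le> k \<and> 2 * int c < int s" if "c \<in> U" for c
    using U(1) that by (force simp: k_def)
  have Dk: "1 \<le> c \<and> int c \<le> k \<and> c \<notin> U" if "c \<in> D" for c
    using D(1) that by (force simp: k_def)
  have k0: "0 \<le> k"
    by (simp add: k_def)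
  have Hval: "H (n + q * N) = G n - q" if "0 \<le> n" "n \<le> int s" for n q
    using that by (simp add: H_def N_def)
  have decomp: "\<exists>n q. 0 \<le> n \<and> n \<le> int s \<and> c = n + q * N" for c
  proof -
    have "0 \<le> c mod N" "c mod N \<le> int s"
      using pos_mod_bound[of N c] pos_mod_sign[of N c] by (simp_all add: N_def)
    moreover have "c = c mod N + (c div N) * N"
      by (rule mod_div_mult_eq[symmetric])
    ultimately show ?thesis by blast
  qed
  have "U \<inter> {..0} = {}" "D \<inter> {..0} = {}"
    using Uk Dk by auto
  then have G0: "G 0 = int e - 1"
    using k0 by (simp add: G_def g_def)
  have "U \<inter> {..s div 2} = U" "D \<inter> {..s div 2} = D"
    using Uk Dk by (auto simp: k_def)
  then have Gk: "G k = - 1"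
    using D(2) by (simp add: G_def g_def k_def)
  have Gsym: "G a = - 2 - G b" if ab: "a + b = int s" for a b
  proof -
    have *: "int s - a = b" "int s - b = a"
      using ab by auto
    have "a \<le> k \<and> \<not> b \<le> k \<or> \<not> a \<le> k \<and> b \<le> k \<or> a = k \<and> b = k"
      using ab s by linarith
    then consider "a \<le> k" "\<not> b \<le> k" | "\<not> a \<le> k" "b \<le> k" | "a = k" "b = k"
      by blast
    then show ?thesis
    proof cases
      case 3
      then show ?thesis
        by (simp add: Gk)
    qed (simp_all add: G_def *)
  qed
  have Gstep: "G n - G (n - 1) = w (nat n)" if "1 \<le> n" "n \<le> k" for n
  proof -
    have "n = int (Suc (nat (n - 1)))"
      using \<open>1 \<le> n\<close> by simp
    then obtain i where i: "n = int (Suc i)"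
      by blast
    let ?c = "\<lambda>A. if Suc i \<in> A then 1 else 0"
    have card: "card (A \<inter> {..Suc i}) = card (A \<inter> {..i}) + ?c A" for A
      by (simp add: atMost_Suc)
    have "G n = g (Suc i)" "G (n - 1) = g i"
      using that i by (simp_all add: G_def nat_add_distrib)
    then show ?thesis
      using Dk[of "Suc i"] i by (auto simp: g_def card w_def nat_add_distrib)
  qed
  have Hstep: "H (n + q * N) - H (n + q * N - 1) = w (\<rho> n)" if n: "0 \<le> n" "n \<le> int s" for n q
  proof (cases "n = 0")
    case True
    have "n + q * N - 1 = int s + (q - 1) * N"
      using True by (simp add: N_def algebra_simps)
    then have "H (n + q * N - 1) = G (int s) - (q - 1)"
      using Hval[of "int s" "q - 1"] by simp
    moreover have "H (n + q * N) = G 0 - q"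
      using Hval[of 0 q] True by simp
    moreover have "\<rho> n = 0"
      using True by (simp add: \<rho>_def N_def)
    ultimately show ?thesis
      using Gsym[of "int s" 0] G0 by (simp add: w_def)
  next
    case False
    have eq: "n + q * N - 1 = (n - 1) + q * N" by simp
    have "H (n + q * N) - H (n + q * N - 1) = G n - G (n - 1)"
      unfolding eq using Hval[of "n - 1" q] Hval[of n q] n False by simp
    also have "\<dots> = w (\<rho> n)"
    proof -
      have "n \<le> k \<or> N - n \<le> k \<and> k < n \<or> n = k + 1 \<and> int s = 2 * k + 1"
        using s by (auto simp: N_def)
      then consider "n \<le> k" | "N - n \<le> k" "k < n" | "n = k + 1" "int s = 2 * k + 1"
        by blast
      then show ?thesis
      proof cases
        case 1
        then have "\<rho> n = nat n"
          using s by (auto simp: \<rho>_def N_def)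
        then show ?thesis
          using Gstep 1 n False by simp
      next
        case 2
        then have "\<rho> n = nat (N - n)"
          by (auto simp: \<rho>_def)
        moreover have "G n = - 2 - G (N - n - 1)" "G (n - 1) = - 2 - G (N - n)"
          by (auto intro!: Gsym simp: N_def)
        ultimately show ?thesis
          using Gstep[of "N - n"] 2 n by (simp add: N_def)
      next
        \<comment> \<open>The middle step for odd \<open>s\<close>: flat, as both of its ends have
          height \<open>- 1\<close>, and its folded position lies in neither set.\<close>
        case 3
        then have "\<rho> n = nat (k + 1)"
          by (simp add: \<rho>_def N_def)
        moreover have "nat (k + 1) \<notin> U" "nat (k + 1) \<notin> D" "nat (k + 1) \<noteq> 0"
          using Uk Dk k0 by fastforce+
        ultimately have "w (\<rho> n) = 0"
          by (simp add: w_def)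
        moreover have "G n = - 2 - G k"
          using 3 by (intro Gsym) simp
        ultimately show ?thesis
          using Gk 3 by simp
      qed
    qed
    finally show ?thesis .
  qed
  have Hup: "H (c - 1) - 1 \<le> H c \<and> H c \<le> H (c - 1) + 1" for c
  proof -
    obtain n q where "0 \<le> n" "n \<le> int s" "c = n + q * N"
      using decomp by blast
    then have "H c - H (c - 1) = w (\<rho> n)"
      using Hstep by blast
    moreover have "- 1 \<le> w (\<rho> n) \<and> w (\<rho> n) \<le> 1"
      using \<open>e \<le> 1\<close> by (auto simp: w_def)
    ultimately show ?thesis by linarith
  qed
  have no_UU: "\<not> (H c = H (c - 1) + 1 \<and> H (c + 1) = H c + 1)" for c
  proof
    assume A: "H c = H (c - 1) + 1 \<and> H (c + 1) = H c + 1"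
    obtain n q where n: "0 \<le> n" "n \<le> int s" "c = n + q * N"
      using decomp by blast
    have 1: "w (\<rho> n) = 1"
      using Hstep[OF n(1,2), of q] A n(3) by simp
    have w1: "e = 1 \<or> i \<noteq> 0" "i = 0 \<or> i \<in> U" if "w i = 1" for i
      using that by (auto simp: w_def split: if_splits)
    have U1: "e = 0 \<or> 1 \<notin> U"
      using U(1) \<open>e \<le> 1\<close> by auto
    show False
    \<comment> \<open>Two up-steps in a row next to a multiple of \<open>N\<close> would be the one
      at \<open>0\<close>, forcing \<open>e = 1\<close>, and one folding to \<open>1\<close>, which
      \<open>U\<close> then excludes. Elsewhere both fold into \<open>U\<close>: to consecutive
      positions, or at the centre of an even \<open>s\<close> to the same position
      \<open>s div 2\<close>, which \<open>U\<close> excludes.\<close>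
    proof (cases "n = int s")
      case True
      then have "c + 1 = 0 + (q + 1) * N"
        using n(3) by (simp add: N_def algebra_simps)
      then have "H (c + 1) - H (c + 1 - 1) = w (\<rho> 0)"
        using Hstep[of 0 "q + 1"] by simp
      then have "w (\<rho> 0) = 1"
        using A by simp
      moreover have "\<rho> 0 = 0" "\<rho> n = 1"
        using True \<open>0 < s\<close> by (auto simp: \<rho>_def N_def)
      ultimately show False
        using 1 w1 U1 by fastforce
    next
      case False
      have eq: "c + 1 = (n + 1) + q * N"
        using n(3) by simp
      have "H (c + 1) - H (c + 1 - 1) = w (\<rho> (n + 1))"
        unfolding eq by (rule Hstep) (use n(1,2) False in auto)
      then have 2: "w (\<rho> (n + 1)) = 1"
        using A by simp
      show False
      proof (cases "n = 0")
        case True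
        then have "\<rho> n = 0" "\<rho> (n + 1) = 1"
          using \<open>0 < s\<close> by (auto simp: \<rho>_def N_def)
        then show False
          using 1 2 w1 U1 by fastforce
      next
        case n0: False
        have "\<rho> n \<noteq> 0" "\<rho> (n + 1) \<noteq> 0"
          using n0 False n by (auto simp: \<rho>_def N_def)
        then have inU: "\<rho> n \<in> U" "\<rho> (n + 1) \<in> U"
          using w1(2)[OF 1] w1(2)[OF 2] by simp_all
        have "n + 1 \<le> N - n - 1 \<or> N - n \<le> n \<or> N = 2 * n + 1"
          by linarith
        then consider "n + 1 \<le> N - n - 1" | "N - n \<le> n" | "N = 2 * n + 1"
          by blast
        then show False
        proof cases
          case 1
          then have "\<rho> (n + 1) = Suc (\<rho> n)"
            using n by (simp add: \<rho>_def nat_eq_iff)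
          then show False
            using inU U(2) by metis
        next
          case 2
          then have "\<rho> n = Suc (\<rho> (n + 1))"
            using n False by (simp add: \<rho>_def N_def nat_eq_iff)
          then show False
            using inU U(2) by metis
        next
          case 3
          then have "int (\<rho> n) = n"
            using n by (simp add: \<rho>_def)
          then show False
            using Uk[OF inU(1)] 3 by (simp add: N_def)
        qed
      qed
    qed
  qed
  show "profile s H"
    unfolding profile_def
  proof (intro conjI allI)
    fix c
    obtain n q where n: "0 \<le> n" "n \<le> int s" "c = n + q * N"
      using decomp by blast
    have Hc: "H c = G n - q"
      unfolding n(3) by (rule Hval[OF n(1,2)])
    have eq: "c + (int s + 1) = n + (q + 1) * N"
      using n(3) by (simp add: N_def algebra_simps)
    show "H (c + (int s + 1)) = H c - 1"
      unfolding eq Hval[OF n(1,2)] Hc by simp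
    have eq: "- 1 - c = (int s - n) + (- 1 - q) * N"
      using n(3) by (simp add: N_def algebra_simps)
    have "H (- 1 - c) = G (int s - n) - (- 1 - q)"
      unfolding eq by (rule Hval) (use n(1,2) in auto)
    then show "H (- 1 - c) = - 1 - H c"
      using Gsym[of "int s - n" n] Hc by simp
    show "H c - 1 \<le> H (c + 1)" "H (c + 1) \<le> H c + 1"
      using Hup[of "c + 1"] by auto
    show "H (c + 2) \<le> H c + 1"
      using Hup[of "c + 1"] Hup[of "c + 2"] no_UU[of "c + 1"] by (simp add: algebra_simps) linarith
  qed
  show "H 0 = int e - 1"
    using Hval[of 0 0] G0 by simp
  have step: "H (int c) - H (int c - 1) = w c" if "c \<in> {1..s div 2}" for c
  proof -
    have "int c \<le> k"
      using that by (simp add: k_def)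
    then have "\<rho> (int c) = c" "int c \<le> int s"
      using s k0 by (auto simp: \<rho>_def N_def)
    then show ?thesis
      using Hstep[of "int c" 0] by simp
  qed
  have "c \<in> ups s H \<longleftrightarrow> c \<in> U" for c
  proof (cases "c \<in> {1..s div 2}")
    case True
    then show ?thesis
      using step[OF True] by (auto simp: ups_def w_def split: if_splits)
  next
    case False
    then show ?thesis
      using Uk[of c] by (auto simp: ups_def k_def)
  qed
  then show "ups s H = U" by blast
  have "c \<in> downs s H \<longleftrightarrow> c \<in> D" for c
  proof (cases "c \<in> {1..s div 2}")
    case True
    then show ?thesis
      using step[OF True] Dk[of c] by (auto simp: downs_def w_def split: if_splits)
  next
    case False
    then show ?thesis
      using Dk[of c] by (auto simp: downs_def k_def)
  qed
  then show "downs s H = D" by blast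
qed

text \<open>The corner count \<open>m\<close> is twice the number of up-steps plus one iff
  \<open>H 0 = 0\<close>. Hence the parity of \<open>m\<close> fixes \<open>H 0\<close>, and
  \<open>m div 2\<close> is the number of up-steps.\<close>

lemma bij_betw_profile_sets:
  assumes "0 < s"
  shows "bij_betw (\<lambda>H. (ups s H, downs s H))
    {H. profile s H \<and> card {x. 0 \<le> H x \<and> \<not> 0 \<le> H (x - 1)} = m}
    {(U, D). U \<subseteq> {Suc (m mod 2)..<(s + 1) div 2} \<and> (\<forall>i\<in>U. Suc i \<notin> U) \<and>
      card U = m div 2 \<and> D \<subseteq> {1..s div 2} - U \<and> card D = m div 2 + m mod 2}"
    (is "bij_betw ?f ?A ?B")
proof (rule bij_betw_imageI)
  have m: "card (ups s H) = m div 2" "(if H 0 = 0 then 1 else 0) = m mod 2"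
    "H 0 = int (m mod 2) - 1" if "H \<in> ?A" for H
    using that card_starts_eq[of s H] profile_0(2)[of s H] \<open>0 < s\<close> by auto
  show "inj_on ?f ?A"
  proof (rule inj_onI)
    fix H H' assume "H \<in> ?A" "H' \<in> ?A" "?f H = ?f H'"
    then show "H = H'"
      using m(3)[of H] m(3)[of H'] profile_eqI[of s H H'] by simp
  qed
  show "?f ` ?A = ?B"
  proof (intro equalityI subsetI)
    fix z assume "z \<in> ?f ` ?A"
    then obtain H where H: "H \<in> ?A" "z = ?f H" by blast
    then have "profile s H" by blast
    show "z \<in> ?B"
      using ups_downs_profile[OF \<open>profile s H\<close> \<open>0 < s\<close>] unfolding m(2)[OF H(1)] H(2) by (simp add: m(1)[OF H(1)])
  next
    fix z assume "z \<in> ?B"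
    then obtain U D where z: "z = (U, D)" and "U \<subseteq> {Suc (m mod 2)..<(s + 1) div 2}"
      "\<forall>i\<in>U. Suc i \<notin> U" "D \<subseteq> {1..s div 2} - U"
      and card: "card U = m div 2" "card D = card U + m mod 2"
      by auto
    moreover have "m mod 2 \<le> 1" by simp
    ultimately obtain H where H: "profile s H" "H 0 = int (m mod 2) - 1" "ups s H = U" "downs s H = D"
      using profile_from_sets[OF \<open>0 < s\<close>] by metis
    moreover have "(if H 0 = 0 then 1 else 0) = m mod 2"
      using H(2) by auto
    ultimately have "card {x. 0 \<le> H x \<and> \<not> 0 \<le> H (x - 1)} = m"
      using card_starts_eq[OF H(1) \<open>0 < s\<close>] card(1) by simp
    then show "z \<in> ?f ` ?A"
      using H z by blast
  qed
qed

section \<open>Profiles of antisymmetric core sets\<close>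

lemma int_downward_closed:
  fixes S :: "int set"
  assumes down: "\<And>i. i \<in> S \<Longrightarrow> i - 1 \<in> S" and "a \<in> S" and bdd: "\<And>i. i \<in> S \<Longrightarrow> i \<le> b"
  obtains h where "\<And>i. i \<in> S \<longleftrightarrow> i \<le> h"
proof
  define h where "h = Max (S \<inter> {a..b})"
  have "h \<in> S \<inter> {a..b}"
    unfolding h_def using \<open>a \<in> S\<close> bdd by (intro Max_in) auto
  show "i \<in> S \<longleftrightarrow> i \<le> h" for i
  proof
    assume "i \<in> S"
    then show "i \<le> h"
      using bdd \<open>h \<in> S \<inter> {a..b}\<close> by (cases "a \<le> i") (auto simp: h_def intro!: Max_ge)
  next
    assume "i \<le> h"
    then show "i \<in> S"
      by (induction i rule: int_le_induct) (use \<open>h \<in> S \<inter> {a..b}\<close> down in auto)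
  qed
qed

text \<open>Closure under \<open>s + 1\<close> makes \<open>X\<close> downward closed on every
  runner. It is bounded above there, and nonempty by antisymmetry, so it is described by a threshold
  \<open>H c\<close>. The clauses of \<open>profile\<close> express the remaining conditions on
  \<open>X\<close>.\<close>

lemma bij_betw_profile:
  "bij_betw (\<lambda>H. {x. 0 \<le> H x}) {H. profile s H}
    {X. (\<forall>x. x \<in> X \<longleftrightarrow> - 1 - x \<notin> X) \<and> (\<exists>b. \<forall>x\<in>X. x < b) \<and>
      (\<forall>t\<in>{s, s + 1, s + 2, s + 3}. \<forall>x\<in>X. x - int t \<in> X)}"
  (is "bij_betw ?f ?A ?B")
proof (rule bij_betw_imageI)
  let ?N = "int s + 1"
  show "inj_on ?f ?A"
  proof (rule inj_onI)
    fix H H' assume H: "H \<in> ?A" "H' \<in> ?A" "?f H = ?f H'"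
    \<comment> \<open>Each side says that \<open>c + q * ?N\<close>, at height
      \<open>H c - q\<close> or \<open>H' c - q\<close>, lies in the common image.\<close>
    have "q \<le> H c \<longleftrightarrow> q \<le> H' c" for c q
      using H(3) profile_add_mult[of s H c q] profile_add_mult[of s H' c q] H(1,2)
      by (auto simp: set_eq_iff dest!: spec[of _ "c + q * ?N"])
    then show "H = H'"
      by (metis order_antisym order_refl ext)
  qed
  show "?f ` ?A = ?B"
  proof (intro equalityI subsetI)
    fix X assume "X \<in> ?f ` ?A"
    then obtain H where H: "profile s H" and X: "X = {x. 0 \<le> H x}" by blast
    have shift: "H (c + q * ?N) = H c - q" for c q
      by (rule profile_add_mult[OF H])
    have "H (- 1 - x) = - 1 - H x" for x
      using H unfolding profile_def by blast
    then have "\<forall>x. x \<in> X \<longleftrightarrow> - 1 - x \<notin> X"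
      unfolding X by auto
    moreover have "\<exists>b. \<forall>x\<in>X. x < b"
    proof (intro exI ballI)
      fix x assume "x \<in> X"
      define M where "M = Max (H ` {0..int s})"
      have "x mod ?N \<in> {0..int s}"
        using pos_mod_bound[of ?N x] by simp
      then have "H (x mod ?N) \<le> M"
        unfolding M_def by (intro Max_ge) auto
      moreover have "H x = H (x mod ?N) - x div ?N"
        using shift[of "x mod ?N" "x div ?N"] unfolding mod_div_mult_eq .
      ultimately have "x div ?N \<le> M"
        using \<open>x \<in> X\<close> by (simp add: X)
      then have "x div ?N * ?N \<le> M * ?N"
        by (intro mult_right_mono) auto
      then show "x < M * ?N + ?N"
        using pos_mod_bound[of ?N x] div_mult_mod_eq[of x ?N] by linarith
    qed
    moreover have "\<forall>t\<in>{s, s + 1, s + 2, s + 3}. \<forall>x\<in>X. x - int t \<in> X"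
    proof (intro ballI)
      fix t x assume t: "t \<in> {s, s + 1, s + 2, s + 3}" and "x \<in> X"
      then have "0 \<le> H x" by (simp add: X)
      \<comment> \<open>Adding the period \<open>s + 1\<close> turns \<open>x - t\<close> into
        \<open>x + 1\<close>, \<open>x\<close>, \<open>x - 1\<close> or \<open>x - 2\<close>, where
        the step inequalities compare heights with \<open>H x\<close>.\<close>
      have "H (x - int t) = H (x - int t + ?N) + 1"
        using shift[of "x - int t" 1] by simp
      moreover have "H x \<le> H (x - int t + ?N) + 1"
        using t profile_step[OF H, of x] profile_step[OF H, of "x + 1"] by auto
      ultimately show "x - int t \<in> X"
        using \<open>0 \<le> H x\<close> by (simp add: X)
    qed
    ultimately show "X \<in> ?B" by blast
  next
    fix X assume "X \<in> ?B"
    then obtain b where anti: "\<And>x. x \<in> X \<longleftrightarrow> - 1 - x \<notin> X" and bdd: "\<And>x. x \<in> X \<Longrightarrow> x < b"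
      and core: "\<And>t x. t \<in> {s, s + 1, s + 2, s + 3} \<Longrightarrow> x \<in> X \<Longrightarrow> x - int t \<in> X"
      by blast
    have "\<exists>h. \<forall>i. c + i * ?N \<in> X \<longleftrightarrow> i \<le> h" for c
    proof -
      \<comment> \<open>A row low enough that \<open>c + a * ?N < - b\<close>, which antisymmetry
        forces into \<open>X\<close>.\<close>
      define a where "a = - (\<bar>b\<bar> + \<bar>c\<bar> + 1)"
      have ge: "\<bar>y\<bar> \<le> \<bar>y * ?N\<bar>" for y
        using mult_left_mono[of 1 ?N "\<bar>y\<bar>"] by (simp add: abs_mult)
      have "a * ?N \<le> a"
        using ge[of a] by (auto simp: a_def abs_if mult_less_0_iff split: if_splits)
      moreover have "a < - b - c"
        by (simp add: a_def)
      ultimately have "c + a * ?N < - b"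
        by linarith
      then have "c + a * ?N \<in> X"
        using negative_mem_antisymmetric[of X b "c + a * ?N"] anti bdd by blast
      moreover have "i \<le> \<bar>b\<bar> + \<bar>c\<bar>" if "c + i * ?N \<in> X" for i
      proof (cases "0 \<le> i")
        case True
        then have "i \<le> i * ?N"
          using ge[of i] by (simp add: abs_mult)
        then show ?thesis
          using bdd[OF that] by linarith
      qed simp
      moreover have "c + (i - 1) * ?N \<in> X" if "c + i * ?N \<in> X" for i
        using core[of "s + 1", OF _ that] by (simp add: algebra_simps)
      ultimately obtain h where "\<And>i. i \<in> {i. c + i * ?N \<in> X} \<longleftrightarrow> i \<le> h"
        using int_downward_closed[of "{i. c + i * ?N \<in> X}" a "\<bar>b\<bar> + \<bar>c\<bar>"] by auto
      then show ?thesis by auto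
    qed
    then obtain H where H: "\<And>c i. c + i * ?N \<in> X \<longleftrightarrow> i \<le> H c"
      by metis
    have eqI: "u = v" if "\<And>i. i \<le> u \<longleftrightarrow> i \<le> v" for u v :: int
      using that by (meson order_antisym order_refl)
    have mem: "c + H c * ?N \<in> X" for c
      by (simp add: H)
    have "profile s H"
      unfolding profile_def
    proof (intro conjI allI)
      fix c
      show "H (c + ?N) = H c - 1"
      proof (rule eqI)
        fix i
        have eq: "c + ?N + i * ?N = c + (i + 1) * ?N"
          by (simp add: algebra_simps)
        have "i \<le> H (c + ?N) \<longleftrightarrow> i + 1 \<le> H c"
          unfolding H[symmetric] eq ..
        then show "i \<le> H (c + ?N) \<longleftrightarrow> i \<le> H c - 1"
          by auto
      qed
      show "H (- 1 - c) = - 1 - H c"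
      proof (rule eqI)
        fix i
        have eq: "- 1 - (- 1 - c + i * ?N) = c + (- i) * ?N"
          by simp
        have "i \<le> H (- 1 - c) \<longleftrightarrow> \<not> - i \<le> H c"
          using anti[of "- 1 - c + i * ?N"] unfolding H eq .
        then show "i \<le> H (- 1 - c) \<longleftrightarrow> i \<le> - 1 - H c"
          by auto
      qed
      have "c + 1 + (H c - 1) * ?N \<in> X"
        using core[of s, OF _ mem[of c]] by (simp add: algebra_simps)
      then show "H c - 1 \<le> H (c + 1)"
        by (simp only: H)
      have "c + (H (c + 1) - 1) * ?N \<in> X"
        using core[of "s + 2", OF _ mem[of "c + 1"]] by (simp add: algebra_simps)
      then show "H (c + 1) \<le> H c + 1"
        by (simp only: H)
      have "c + (H (c + 2) - 1) * ?N \<in> X"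
        using core[of "s + 3", OF _ mem[of "c + 2"]] by (simp add: algebra_simps)
      then show "H (c + 2) \<le> H c + 1"
        by (simp only: H)
    qed
    moreover have "X = ?f H"
      using H[of _ 0] by auto
    ultimately show "X \<in> ?f ` ?A" by blast
  qed
qed

subsection \<open>Counting\<close>

text \<open>The Fibonacci-type recursion on the largest position \<open>a + Suc n\<close> of the
  interval: it is left out, or it is taken and \<open>a + n\<close> is barred. Pascal's rule solves
  it. For positive \<open>n\<close> the interval has \<open>n - 1\<close> elements.\<close>

lemma card_sparse_subsets:
  "card {U. U \<subseteq> {Suc a..<a + n} \<and> (\<forall>i\<in>U. Suc i \<notin> U) \<and> card U = r} = (n - r) choose r"
proof (induction n arbitrary: r rule: induct_nat_012)
  case 0
  have "{U. U \<subseteq> {Suc a..<a + 0} \<and> (\<forall>i\<in>U. Suc i \<notin> U) \<and> card U = r} = (if r = 0 then {{}} else {})"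
    by auto
  then show ?case by (cases r) auto
next
  case 1
  have "{U. U \<subseteq> {Suc a..<a + Suc 0} \<and> (\<forall>i\<in>U. Suc i \<notin> U) \<and> card U = r} = (if r = 0 then {{}} else {})"
    by auto
  then show ?case by (cases r) auto
next
  case (ge2 n)
  define F where "F n r = {U. U \<subseteq> {Suc a..<a + n} \<and> (\<forall>i\<in>U. Suc i \<notin> U) \<and> card U = r}" for n r
  have fin: "finite (F n r)" for n r
    unfolding F_def by (rule finite_subset[of _ "Pow {Suc a..<a + n}"]) auto
  have finU: "finite U" if "U \<in> F n r" for U n r
    using that finite_subset[of U] by (auto simp: F_def)
  show ?case
  proof (cases r)
    case 0
    have "{U. U \<subseteq> {Suc a..<a + Suc (Suc n)} \<and> (\<forall>i\<in>U. Suc i \<notin> U) \<and> card U = 0} = {{}}"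
      using finite_subset by fastforce
    then show ?thesis
      using 0 by simp
  next
    case (Suc t)
    let ?x = "a + Suc n"
    have "F (Suc (Suc n)) (Suc t) = F (Suc n) (Suc t) \<union> insert ?x ` F n t"
    proof (intro equalityI subsetI)
      fix U assume U: "U \<in> F (Suc (Suc n)) (Suc t)"
      show "U \<in> F (Suc n) (Suc t) \<union> insert ?x ` F n t"
      proof (cases "?x \<in> U")
        case False
        then have "U \<subseteq> {Suc a..<a + Suc n}"
          using U by (force simp: F_def less_Suc_eq)
        then show ?thesis
          using U by (auto simp: F_def)
      next
        case True
        have "a + n \<notin> U"
          using True U by (auto simp: F_def)
        then have "U - {?x} \<subseteq> {Suc a..<a + n}"
          using U by (force simp: F_def less_Suc_eq)
        then have "U - {?x} \<in> F n t"
          using U True finU[OF U] by (auto simp: F_def)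
        then show ?thesis
          using True by (metis UnI2 image_eqI insert_Diff)
      qed
    next
      fix U assume "U \<in> F (Suc n) (Suc t) \<union> insert ?x ` F n t"
      then consider "U \<in> F (Suc n) (Suc t)" | V where "V \<in> F n t" "U = insert ?x V"
        by blast
      then show "U \<in> F (Suc (Suc n)) (Suc t)"
      proof cases
        case 1
        then show ?thesis by (force simp: F_def)
      next
        case 2
        then have "?x \<notin> V" "Suc ?x \<notin> V" "a + n \<notin> V"
          by (auto simp: F_def)
        then show ?thesis
          using 2 finU[OF 2(1)] by (force simp: F_def)
      qed
    qed
    moreover have "F (Suc n) (Suc t) \<inter> insert ?x ` F n t = {}"
      by (auto simp: F_def)
    moreover have "inj_on (insert ?x) (F n t)"
      by (rule inj_onI) (auto simp: F_def dest!: insert_ident[THEN iffD1, rotated -1])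
    ultimately have "card (F (Suc (Suc n)) (Suc t)) = card (F (Suc n) (Suc t)) + card (F n t)"
      using fin by (simp add: card_Un_disjoint card_image)
    also have "\<dots> = (n - t choose Suc t) + (n - t choose t)"
      using ge2.IH(1)[of t] ge2.IH(2)[of "Suc t"] by (simp add: F_def)
    \<comment> \<open>For \<open>t > n\<close> the subtractions truncate to \<open>0\<close> and all
      three binomials vanish.\<close>
    also have "\<dots> = (Suc n - t) choose Suc t"
      by (cases "t \<le> n") (auto simp: Suc_diff_le)
    finally show ?thesis
      using Suc by (simp add: F_def)
  qed
qed

text \<open>After \<open>U\<close> is chosen, \<open>D\<close> is any \<open>q\<close>-subset of the
  remaining \<open>k - r\<close> positions; \<open>l \<le> Suc k\<close> places \<open>U\<close>
  inside \<open>{1..k}\<close>.\<close>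

lemma card_sparse_pairs:
  fixes e l k r q :: nat
  assumes "e \<le> l" "l \<le> Suc k"
  defines "P \<equiv> {(U, D). U \<subseteq> {Suc e..<l} \<and> (\<forall>i\<in>U. Suc i \<notin> U) \<and> card U = r \<and>
      D \<subseteq> {1..k} - U \<and> card D = q}"
  shows "finite P" "card P = ((l - e - r) choose r) * ((k - r) choose q)"
proof -
  let ?S = "{U. U \<subseteq> {Suc e..<e + (l - e)} \<and> (\<forall>i\<in>U. Suc i \<notin> U) \<and> card U = r}"
  let ?T = "\<lambda>U. {D. D \<subseteq> {1..k} - U \<and> card D = q}"
  have P: "P = (SIGMA U:?S. ?T U)"
    using assms(1) by (auto simp: P_def)
  have fin: "finite ?S"
    by (rule finite_subset[of _ "Pow {Suc e..<e + (l - e)}"]) auto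
  moreover have finT: "finite (?T U)" for U
    by (rule finite_subset[of _ "Pow {1..k}"]) auto
  ultimately show "finite P"
    unfolding P by simp
  have "card (?T U) = (k - r) choose q" if "U \<in> ?S" for U
  proof -
    have "U \<subseteq> {1..k}" "card U = r"
      using that assms(1,2) by auto
    then have "card ({1..k} - U) = k - r"
      by (simp add: card_Diff_subset finite_subset)
    then show ?thesis
      by (simp add: n_subsets)
  qed
  then have "card P = card ?S * ((k - r) choose q)"
    unfolding P using fin finT by (simp add: card_SigmaI)
  then show "card P = ((l - e - r) choose r) * ((k - r) choose q)"
    unfolding card_sparse_subsets by simp
qed

section \<open>Combining the bijections with the count\<close>

lemma int_binom_of_nat: "int_binom (int a) (int b) = real (a choose b)"
  by (simp add: int_binom_def binomial_gbinomial)

lemma bij_betw_restrict: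
  assumes "bij_betw f A B"
  shows "bij_betw f {x \<in> A. Q (f x)} {y \<in> B. Q y}"
  using assms by (auto simp: bij_betw_def inj_on_def)

lemma bij_betw_maya:
  assumes "0 < s"
  shows "bij_betw maya
    {p. is_partition p \<and> self_conjugate p \<and>
        is_simultaneous_core {s, s + 1, s + 2, s + 3} p \<and> corners p = m}
    {X \<in> {X. (\<forall>x. x \<in> X \<longleftrightarrow> - 1 - x \<notin> X) \<and> (\<exists>b. \<forall>x\<in>X. x < b) \<and>
        (\<forall>t\<in>{s, s + 1, s + 2, s + 3}. \<forall>x\<in>X. x - int t \<in> X)}.
      card {x \<in> X. x - 1 \<notin> X} = m}"
    (is "bij_betw maya ?C ?X")
proof (rule bij_betw_imageI)
  show "inj_on maya ?C"
    using inj_on_maya by (rule inj_on_subset) auto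
  have core: "is_simultaneous_core {s, s + 1, s + 2, s + 3} p \<longleftrightarrow>
      (\<forall>t\<in>{s, s + 1, s + 2, s + 3}. \<forall>x\<in>maya p. x - int t \<in> maya p)" if "is_partition p" for p
    unfolding is_simultaneous_core_def using is_core_iff_maya[OF that] \<open>0 < s\<close> by auto
  have bdd: "\<exists>b. \<forall>x\<in>maya p. x < b" if "is_partition p" for p
    using maya_less[OF that] by blast
  have iff: "p \<in> ?C \<longleftrightarrow> maya p \<in> ?X" if "is_partition p" for p
    using that bdd[OF that]
    by (simp only: mem_Collect_eq self_conjugate_iff_maya[OF that] corners_eq_card_maya[OF that]
        core[OF that] simp_thms conj_assoc)
  show "maya ` ?C = ?X"
  proof (intro equalityI subsetI)
    fix X assume "X \<in> maya ` ?C"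
    then obtain p where p: "p \<in> ?C" "X = maya p"
      by (rule imageE)
    then have "is_partition p"
      by (elim CollectE conjE)
    from iff[OF this] p(1) show "X \<in> ?X"
      unfolding p(2) by (rule iffD1)
  next
    fix X assume X: "X \<in> ?X"
    from X have anti: "\<forall>x. x \<in> X \<longleftrightarrow> - 1 - x \<notin> X"
      by (elim CollectE conjE)
    from X have "\<exists>b. \<forall>x\<in>X. x < b"
      by (elim CollectE conjE)
    then obtain b where b: "\<forall>x\<in>X. x < b" ..
    obtain p where p: "is_partition p" "maya p = X"
      by (rule maya_surj[OF anti[rule_format] b[rule_format]])
    from iff[OF p(1)] X have "p \<in> ?C"
      unfolding p(2) by (rule iffD2)
    then have "maya p \<in> maya ` ?C"
      by (rule imageI)
    then show "X \<in> maya ` ?C"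
      unfolding p(2) .
  qed
qed

theorem proposition3p10:
  fixes s m :: nat
  assumes "0 < s"
  defines "C \<equiv> {p. is_partition p \<and> self_conjugate p \<and>
                   is_simultaneous_core {s, s + 1, s + 2, s + 3} p \<and> corners p = m}"
  shows "finite C \<and>
    real (card C) =
      int_binom (\<lfloor>real s / 2\<rfloor> - \<lfloor>real m / 2\<rfloor>) (\<lfloor>real s / 2\<rfloor> - int m) *
      int_binom (\<lfloor>real (s + 1) / 2\<rfloor> - \<lfloor>real (m + 1) / 2\<rfloor>) \<lfloor>real m / 2\<rfloor>"
proof -
  define k where "k = s div 2"
  define l where "l = (s + 1) div 2"
  define r where "r = m div 2"
  define e where "e = m mod 2"
  have m: "m = 2 * r + e" "(m + 1) div 2 = r + e" "e \<le> 1"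
    unfolding r_def e_def by presburger+
  have "0 < l"
    using \<open>0 < s\<close> by (simp add: l_def div_greater_zero_iff)
  then have kl: "e \<le> l" "k \<le> l" "l \<le> Suc k"
    using \<open>e \<le> 1\<close> by (auto simp: k_def l_def intro: div_le_mono)
  define P where "P = {(U, D). U \<subseteq> {Suc e..<l} \<and> (\<forall>i\<in>U. Suc i \<notin> U) \<and> card U = r \<and>
      D \<subseteq> {1..k} - U \<and> card D = r + e}"
  define \<H> where "\<H> = {H. profile s H \<and> card {x. 0 \<le> H x \<and> \<not> 0 \<le> H (x - 1)} = m}"
  have "\<exists>f. bij_betw f \<H> P"
    unfolding \<H>_def P_def k_def l_def r_def e_def using bij_betw_profile_sets[OF \<open>0 < s\<close>] by blast
  moreover obtain X where "bij_betw maya C X" "bij_betw (\<lambda>H. {x. 0 \<le> H x}) \<H> X"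
    using bij_betw_maya[OF \<open>0 < s\<close>, of m]
      bij_betw_restrict[OF bij_betw_profile, where Q = "\<lambda>X. card {x \<in> X. x - 1 \<notin> X} = m"]
    unfolding C_def \<H>_def mem_Collect_eq by blast
  ultimately have "finite C \<longleftrightarrow> finite P" "card C = card P"
    using bij_betw_finite bij_betw_same_card by metis+
  then have C: "finite C" "card C = ((l - e - r) choose r) * ((k - r) choose (r + e))"
    using card_sparse_pairs[OF kl(1,3)] unfolding P_def by simp_all
  have half: "\<lfloor>real n / 2\<rfloor> = int (n div 2)" for n
    using floor_divide_of_nat_eq[of n 2] by simp
  \<comment> \<open>As \<open>(k - r) - (k - m) = r + e\<close>, the first factor is the symmetric
    form of choosing the down-steps. For \<open>m > k\<close> its lower entry is negative, and
    correspondingly \<open>r + e\<close> exceeds the available \<open>k - r\<close>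
    positions.\<close>
  have "real (card C) = int_binom (int k - int r) (int k - int m) * int_binom (int l - int (r + e)) (int r)"
  proof (cases "m \<le> k")
    case True
    then have "int k - int r = int (k - r)" "int k - int m = int (k - m)"
      "int l - int (r + e) = int (l - e - r)"
      using m(1) kl by auto
    moreover have "(k - r) choose (k - m) = (k - r) choose (r + e)"
      using binomial_symmetric[of "k - m" "k - r"] True m(1) by simp
    ultimately show ?thesis
      unfolding C(2) by (simp only: int_binom_of_nat of_nat_mult mult.commute)
  next
    case False
    then have "(k - r) choose (r + e) = 0"
      using m(1) by (intro binomial_eq_0) auto
    then show ?thesis
      unfolding C(2) using False by (simp add: int_binom_def)
  qed
  then show ?thesis
    using C(1) unfolding half m(2) k_def[symmetric] l_def[symmetric] r_def[symmetric] by blast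
qed

end
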